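(* For $c$ sufficiently small, the expected revenue in Scheme 2 (searchers pay the per-transaction cost $c$ of revert protection) is greater than the expected profit in Scheme 1 (the sequencer internalizes the per-transaction cost $c$) under the profit-optimal choice of $r_1$.
   Context: Auction game. $N\ge2$ agents (searchers) compete for a single opportunity of common value $V>0$; $g>0$ is the base fee, with $V>g$; $r_1,r_2\in[0,1]$ are the revert penalty rates on the base fee and on the priority fee. Each agent either abstains or submits a priority-fee bid $b_i\ge0$. The highest participating bidder $w$ wins (ties broken at random), receives value $V$ and pays $g+b_w$; every other participating agent $j$ receives no value and pays $r_1g+r_2b_j$; abstaining agents receive and pay nothing. A mixed strategy is a pair $(p,F)$: abstain with probability $p\in[0,1]$, otherwise draw the bid from a continuous cdf $F$ on $[0,\infty)$; agents randomize independently and maximize expected payoff. A symmetric equilibrium is a Nash equilibrium in which all agents use the same mixed strategy. Expected revenue is the expected total of the payments the sequencer (auctioneer) collects from the agents. The cost of implementing revert protection, per submitted transaction (i.e. per participating agent), is $c$, with $0<c<V-g$. Scheme 1. The sequencer bears the cost $c$ per submitted transaction itself. The agents' game is unchanged: bidding $b_i\ge0$ against the other agents' strategies $\beta_{-i}$ gives expected payoff $(V-g-b_i)P-(r_1g+r_2b_i)(1-P)$ with $P=\mathbb P(w=i\mid b_i,\beta_{-i})$, and abstaining gives $0$. When at least one of $r_1,r_2$ is nonzero, the unique symmetric mixed-strategy equilibrium has abstention probability $p^*=\left(\frac{r_1g}{V-g+r_1g}\right)^{1/(N-1)}$, and the sequencer's expected profit is expected revenue minus $c$ times the expected number of submitted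 transactions, that is, $(1-(p^* )^N)V-c(1-p^* )N$. The profit-optimal choice of $r_1$ is the one maximizing this expected profit over $r_1\in[0,1]$. Scheme 2. Each participating agent pays the sequencer the amount $c$ upfront, so bidding $b_i\ge0$ gives expected payoff $(V-g-b_i)P-(r_1g+r_2b_i)(1-P)-c$ with $P=\mathbb P(w=i\mid b_i,\beta_{-i})$, and abstaining gives $0$. When at least one of $r_1,r_2$ is nonzero, the unique symmetric mixed-strategy equilibrium has abstention probability $p^*=\left(\frac{r_1g+c}{V-g+r_1g}\right)^{1/(N-1)}$, and, conditional on participating, bids are drawn from the cdf $F^*(b)=\frac1{1-p^*}\left(\left(\frac{r_1g+r_2b+c}{V-g-b+r_1g+r_2b}\right)^{1/(N-1)}-p^*\right)$, with every agent's expected payoff equal to zero. Expected revenue in Scheme 2 is evaluated at this equilibrium. *)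

theory Defs
  imports "HOL-Probability.Probability"
begin

text \<open>
  Agents are \<open>0, \<dots>, N - 1\<close>. An action is a pair (participates, bid); the bid component of an
  abstaining agent is ignored. The parameter \<open>f\<close> is the upfront fee a participating agent pays to
  the sequencer: \<open>f = 0\<close> in Scheme 1 and \<open>f = c\<close> in Scheme 2.
\<close>

type_synonym action = "bool \<times> real"

definition top_bidders :: "nat \<Rightarrow> (nat \<Rightarrow> action) \<Rightarrow> nat set" where
  "top_bidders N a =
     {i. i < N \<and> fst (a i) \<and> (\<forall>j<N. fst (a j) \<longrightarrow> snd (a j) \<le> snd (a i))}"

text \<open>Winning probability given the action profile: ties are broken uniformly at random.\<close>

definition win_chance :: "nat \<Rightarrow> (nat \<Rightarrow> action) \<Rightarrow> nat \<Rightarrow> real" where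
  "win_chance N a i =
     (if i \<in> top_bidders N a then 1 / real (card (top_bidders N a)) else 0)"

definition payment ::
  "nat \<Rightarrow> real \<Rightarrow> real \<Rightarrow> real \<Rightarrow> real \<Rightarrow> (nat \<Rightarrow> action) \<Rightarrow> nat \<Rightarrow> real" where
  "payment N g r1 r2 f a i =
     (if fst (a i)
      then (g + snd (a i)) * win_chance N a i
           + (r1 * g + r2 * snd (a i)) * (1 - win_chance N a i) + f
      else 0)"

definition payoff ::
  "nat \<Rightarrow> real \<Rightarrow> real \<Rightarrow> real \<Rightarrow> real \<Rightarrow> real \<Rightarrow> (nat \<Rightarrow> action) \<Rightarrow> nat \<Rightarrow> real" where
  "payoff N V g r1 r2 f a i =
     (if fst (a i)
      then (V - g - snd (a i)) * win_chance N a i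
           - (r1 * g + r2 * snd (a i)) * (1 - win_chance N a i) - f
      else 0)"

text \<open>
  A mixed strategy is given by the abstention probability \<open>p\<close> and the law \<open>D\<close> of the bid
  conditional on participating; \<open>cdf D\<close> is the function written \<open>F\<close> in the mathematics.
\<close>

definition mixed_strategy :: "real \<Rightarrow> real measure \<Rightarrow> bool" where
  "mixed_strategy p D \<longleftrightarrow>
     0 \<le> p \<and> p \<le> 1 \<and> real_distribution D \<and>
     continuous_on UNIV (cdf D) \<and> measure D {..<0} = 0"

definition profile_law :: "nat \<Rightarrow> real \<Rightarrow> real measure \<Rightarrow> (nat \<Rightarrow> action) measure" where
  "profile_law N p D =
     (\<Pi>\<^sub>M i\<in>{..<N}. measure_pmf (bernoulli_pmf (1 - p)) \<Otimes>\<^sub>M D)"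

text \<open>
  Integrability is required because the Bochner integral of a non-integrable function is 0,
  whereas the payoff of a bid law with infinite mean should count as minus infinity. Deviations
  \<open>x\<close> range over abstaining and over all nonnegative bids.
\<close>

definition symmetric_equilibrium ::
  "nat \<Rightarrow> real \<Rightarrow> real \<Rightarrow> real \<Rightarrow> real \<Rightarrow> real \<Rightarrow> real \<Rightarrow> real measure \<Rightarrow> bool" where
  "symmetric_equilibrium N V g r1 r2 f p D \<longleftrightarrow>
     mixed_strategy p D \<and>
     (\<forall>i<N.
        integrable (profile_law N p D) (\<lambda>a. payoff N V g r1 r2 f a i) \<and>
        (\<forall>x. (fst x \<longrightarrow> 0 \<le> snd x) \<longrightarrow>
           (LINT a|profile_law N p D. payoff N V g r1 r2 f (a(i := x)) i)
           \<le> (LINT a|profile_law N p D. payoff N V g r1 r2 f a i)))"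

definition expected_revenue ::
  "nat \<Rightarrow> real \<Rightarrow> real \<Rightarrow> real \<Rightarrow> real \<Rightarrow> real \<Rightarrow> real measure \<Rightarrow> real" where
  "expected_revenue N g r1 r2 f p D =
     (LINT a|profile_law N p D. (\<Sum>i<N. payment N g r1 r2 f a i))"

definition expected_submissions :: "nat \<Rightarrow> real \<Rightarrow> real measure \<Rightarrow> real" where
  "expected_submissions N p D =
     (LINT a|profile_law N p D. real (card {i. i < N \<and> fst (a i)}))"

definition scheme1_equilibrium ::
  "nat \<Rightarrow> real \<Rightarrow> real \<Rightarrow> real \<Rightarrow> real \<Rightarrow> real \<Rightarrow> real measure \<Rightarrow> bool" where
  "scheme1_equilibrium N V g r1 r2 p D \<longleftrightarrow> symmetric_equilibrium N V g r1 r2 0 p D"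

definition scheme1_profit ::
  "nat \<Rightarrow> real \<Rightarrow> real \<Rightarrow> real \<Rightarrow> real \<Rightarrow> real \<Rightarrow> real measure \<Rightarrow> real" where
  "scheme1_profit N g r1 r2 c p D =
     expected_revenue N g r1 r2 0 p D - c * expected_submissions N p D"

definition scheme2_equilibrium ::
  "nat \<Rightarrow> real \<Rightarrow> real \<Rightarrow> real \<Rightarrow> real \<Rightarrow> real \<Rightarrow> real \<Rightarrow> real measure \<Rightarrow> bool" where
  "scheme2_equilibrium N V g r1 r2 c p D \<longleftrightarrow> symmetric_equilibrium N V g r1 r2 c p D"

definition scheme2_revenue ::
  "nat \<Rightarrow> real \<Rightarrow> real \<Rightarrow> real \<Rightarrow> real \<Rightarrow> real \<Rightarrow> real measure \<Rightarrow> real" where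
  "scheme2_revenue N g r1 r2 c p D = expected_revenue N g r1 r2 c p D"

text \<open>
  Optimal choices of \<open>r1\<close> in \<open>[0, 1]\<close> for fixed \<open>r2\<close>, each rate being judged by its value at
  symmetric equilibrium. Existence of an equilibrium at the optimal rate is part of the notion;
  rates without one (Scheme 1 with \<open>r1 = r2 = 0\<close>) do not compete.
\<close>

definition scheme1_optimal :: "nat \<Rightarrow> real \<Rightarrow> real \<Rightarrow> real \<Rightarrow> real \<Rightarrow> real \<Rightarrow> bool" where
  "scheme1_optimal N V g r2 c r1 \<longleftrightarrow>
     r1 \<in> {0..1} \<and>
     (\<exists>p D. scheme1_equilibrium N V g r1 r2 p D) \<and>
     (\<forall>p D r' p' D'.
        scheme1_equilibrium N V g r1 r2 p D \<and>
        r' \<in> {0..1} \<and> scheme1_equilibrium N V g r' r2 p' D' \<longrightarrow>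
        scheme1_profit N g r' r2 c p' D' \<le> scheme1_profit N g r1 r2 c p D)"

definition scheme2_optimal :: "nat \<Rightarrow> real \<Rightarrow> real \<Rightarrow> real \<Rightarrow> real \<Rightarrow> real \<Rightarrow> bool" where
  "scheme2_optimal N V g r2 c r1 \<longleftrightarrow>
     r1 \<in> {0..1} \<and>
     (\<exists>p D. scheme2_equilibrium N V g r1 r2 c p D) \<and>
     (\<forall>p D r' p' D'.
        scheme2_equilibrium N V g r1 r2 c p D \<and>
        r' \<in> {0..1} \<and> scheme2_equilibrium N V g r' r2 c p' D' \<longrightarrow>
        scheme2_revenue N g r' r2 c p' D' \<le> scheme2_revenue N g r1 r2 c p D)"

end

theory Submission
  imports Defs
begin

text \<open>
  In a symmetric equilibrium every agent earns zero. If abstention has positive probability, this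
  is indifference with abstaining. If not, then since bid laws are atomless there are equilibrium
  bids that win with probability close to 0; these cannot earn a positive amount, yet they earn
  the equilibrium payoff. Comparing with the bid 0, which wins exactly when everybody else
  abstains, gives \<open>p ^ (N - 1) * (V - g + r1 * g) = r1 * g + f\<close>, and the revenue is the whole
  generated surplus \<open>(1 - p ^ N) * V\<close>.

  The Scheme 1 profit is thus \<open>(1 - p ^ N) * V - c * N * (1 - p)\<close>, uniquely maximal at
  \<open>p ^ (N - 1) = c / V\<close> with value \<open>V - c * (N - (N - 1) * p)\<close>. At the same \<open>r1\<close>, Scheme 2
  abstains with probability \<open>q\<close> where \<open>q ^ (N - 1) = c * (2 * V - g - c) / ((V - g) * V)\<close>, so it
  loses only \<open>V * q ^ N = o(c)\<close> of \<open>V\<close>, while Scheme 1 loses about \<open>c * N\<close>.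
\<close>

subsection \<open>Interim payoffs against a symmetric profile\<close>

lemma win_chance_bounds: "0 \<le> win_chance N a i" "win_chance N a i \<le> 1"
  by (auto simp: win_chance_def divide_le_eq)

text \<open>Without ties the set of top bidders is either \<open>{i}\<close> or misses
  \<open>i\<close>, so the tie-breaking lottery disappears. The premise has the form that holds
  almost surely by \<open>AE_no_tie\<close>.\<close>

lemma win_chance_no_tie:
  assumes "i < N" and "\<forall>j\<in>{..<N}. snd (a j) \<noteq> b"
  shows "win_chance N (a(i := (True, b))) i =
    of_bool (\<forall>j\<in>{..<N} - {i}. fst (a j) \<longrightarrow> snd (a j) \<le> b)"
proof (cases "\<forall>j\<in>{..<N} - {i}. fst (a j) \<longrightarrow> snd (a j) \<le> b")
  case True
  have "top_bidders N (a(i := (True, b))) = {i}"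
  proof (rule set_eqI)
    fix j
    show "j \<in> top_bidders N (a(i := (True, b))) \<longleftrightarrow> j \<in> {i}"
    proof (cases "j = i")
      case False
      have "j \<notin> top_bidders N (a(i := (True, b)))"
      proof
        assume j: "j \<in> top_bidders N (a(i := (True, b)))"
        have "snd (a j) \<le> b" using True j False by (auto simp: top_bidders_def)
        moreover have "snd ((a(i := (True, b))) i) \<le> snd ((a(i := (True, b))) j)"
          using j assms(1) unfolding top_bidders_def by fastforce
        moreover have "j < N" using j by (simp add: top_bidders_def)
        ultimately show False using assms(2) False by fastforce
      qed
      then show ?thesis using False by simp
    qed (use True assms(1) in \<open>auto simp: top_bidders_def\<close>)
  qed
  then show ?thesis using True by (simp add: win_chance_def)
next
  case False
  then have "i \<notin> top_bidders N (a(i := (True, b)))"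
    by (auto simp: top_bidders_def)
  then show ?thesis using False by (simp add: win_chance_def)
qed

text \<open>As soon as somebody participates, the highest bid is attained and the equal shares of
  the top bidders add up to one.\<close>

lemma sum_win_chance:
  "(\<Sum>i<N. win_chance N a i) = (if \<forall>i<N. \<not> fst (a i) then 0 else 1)"
proof (cases "\<forall>i<N. \<not> fst (a i)")
  case True
  then show ?thesis by (auto simp: win_chance_def top_bidders_def)
next
  case False
  define S where "S = {i. i < N \<and> fst (a i)}"
  have fin: "finite ((\<lambda>i. snd (a i)) ` S)" and "S \<noteq> {}" using False by (auto simp: S_def)
  then obtain i where "i \<in> S" "snd (a i) = Max ((\<lambda>i. snd (a i)) ` S)"
    by (metis (no_types, lifting) Max_in image_iff image_is_empty)
  then have "i \<in> top_bidders N a"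
    using Max_ge[OF fin] by (auto simp: top_bidders_def S_def)
  moreover have "top_bidders N a \<subseteq> {..<N}" by (auto simp: top_bidders_def)
  moreover have "finite (top_bidders N a)" using calculation(2) finite_subset by blast
  ultimately have "(\<Sum>i\<in>top_bidders N a. 1 / real (card (top_bidders N a))) = 1"
    by auto
  moreover have "(\<Sum>i<N. win_chance N a i) = (\<Sum>i\<in>top_bidders N a. 1 / real (card (top_bidders N a)))"
    using \<open>top_bidders N a \<subseteq> {..<N}\<close>
    by (simp add: win_chance_def sum.If_cases Int_absorb1)
  ultimately show ?thesis using False by simp
qed

text \<open>The sequencer collects whatever value an agent wins but does not keep, so revenue
  reduces to value generated minus payoffs.\<close>

lemma payment_eq: "payment N g r1 r2 f a i = V * win_chance N a i - payoff N V g r1 r2 f a i"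
proof -
  have "win_chance N a i = 0" if "\<not> fst (a i)" using that by (simp add: win_chance_def top_bidders_def)
  then show ?thesis by (simp add: payment_def payoff_def algebra_simps)
qed

section \<open>One agent's law: ties, measurability, resampling\<close>

definition agent_law :: "real \<Rightarrow> real measure \<Rightarrow> action measure" where
  "agent_law p D = measure_pmf (bernoulli_pmf (1 - p)) \<Otimes>\<^sub>M D"

text \<open>Equilibrium is not assumed here but lemma by lemma, so that the same interim formulas
  serve both to analyse equilibria and to construct one.\<close>

locale symmetric_profile =
  fixes N :: nat and p :: real and D :: "real measure"
  assumes mixed: "mixed_strategy p D"
begin

sublocale D: real_distribution D
  using mixed by (simp add: mixed_strategy_def)

sublocale P: pair_prob_space "measure_pmf (bernoulli_pmf (1 - p))" D ..

lemma p_bounds: "0 \<le> p" "p \<le> 1"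
  using mixed by (auto simp: mixed_strategy_def)

abbreviation "A \<equiv> agent_law p D"

lemma prob_space_agent: "prob_space A"
  unfolding agent_law_def by (rule P.prob_space_axioms)

lemma sets_agent [measurable_cong]: "sets A = sets (count_space UNIV \<Otimes>\<^sub>M borel)"
  unfolding agent_law_def by (intro sets_pair_measure_cong) auto

lemma space_agent [simp]: "space A = UNIV"
  using sets_eq_imp_space_eq[OF sets_agent] by (simp add: space_pair_measure)

abbreviation "PL \<equiv> profile_law N p D"

lemma profile_law_eq: "PL = (\<Pi>\<^sub>M i\<in>{..<N}. A)"
  by (simp add: profile_law_def agent_law_def)

sublocale PL: prob_space PL
  unfolding profile_law_eq by (rule prob_space_PiM) (rule prob_space_agent)

sublocale pair_AP: pair_prob_space A PL
proof -
  interpret A: prob_space A by (rule prob_space_agent)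
  show "pair_prob_space A PL" ..
qed

text \<open>Continuity rules out an atom at 0, and no mass lies below it. Hence the bid 0 beats only
  abstainers.\<close>

lemma cdf_eq_0: "cdf D 0 = 0"
proof -
  have "measure D {0} = 0"
    using mixed D.isCont_cdf by (auto simp: mixed_strategy_def continuous_on_eq_continuous_at)
  moreover have "measure D {..<0} = 0" using mixed by (auto simp: mixed_strategy_def)
  moreover have "measure D {..0} = measure D ({..<0} \<union> {0})"
    by (rule arg_cong[where f="measure D"]) auto
  ultimately show ?thesis
    by (subst (asm) D.finite_measure_Union) (auto simp: cdf_def)
qed

lemma no_atom: "emeasure D {b} = 0"
  using mixed D.isCont_cdf
  by (auto simp: mixed_strategy_def continuous_on_eq_continuous_at D.emeasure_eq_measure)

lemma AE_agent_bid:
  assumes "AE b in D. Q b"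
  shows "AE z in A. Q (snd z)"
proof -
  obtain X where X: "{b \<in> space D. \<not> Q b} \<subseteq> X" "emeasure D X = 0" "X \<in> sets D"
    using assms by (rule AE_E)
  show ?thesis
  proof (rule AE_I)
    show "{z \<in> space A. \<not> Q (snd z)} \<subseteq> UNIV \<times> X" using X by auto
    show "emeasure A (UNIV \<times> X) = 0"
      unfolding agent_law_def using X by (subst D.emeasure_pair_measure_Times) auto
    show "UNIV \<times> X \<in> sets A" unfolding sets_agent using X by auto
  qed
qed

lemma AE_agent_no_tie: "AE z in A. snd z \<noteq> b"
  by (rule AE_agent_bid, rule AE_I[where N="{b}"]) (auto simp: no_atom)

text \<open>The event that one rival does not outbid \<open>b\<close> splits into abstaining and
  participating with a bid of at most \<open>b\<close>.\<close>

lemma measure_not_above: "measure A {z. fst z \<longrightarrow> snd z \<le> b} = p + (1 - p) * cdf D b"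
proof -
  have "{z::action. fst z \<longrightarrow> snd z \<le> b} = {False} \<times> UNIV \<union> {True} \<times> {..b}" by auto
  moreover have "measure A (X \<times> Y) = measure (measure_pmf (bernoulli_pmf (1 - p))) X * measure D Y"
    if "Y \<in> sets borel" for X Y
    unfolding agent_law_def measure_def using that
    by (subst D.emeasure_pair_measure_Times) (auto simp: enn2real_mult)
  then have "measure A ({False} \<times> UNIV) = p" "measure A ({True} \<times> {..b}) = (1 - p) * cdf D b"
    using p_bounds D.prob_space by (auto simp: measure_pmf_single cdf_def)
  moreover have "measure A ({False} \<times> UNIV \<union> {True} \<times> {..b})
      = measure A ({False} \<times> UNIV) + measure A ({True} \<times> {..b})"
    by (intro pair_AP.M1.finite_measure_Union) (auto simp: sets_agent)
  ultimately show ?thesis by simp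
qed

lemma measurable_agent [measurable]:
  "i < N \<Longrightarrow> (\<lambda>a. a i) \<in> measurable PL (count_space UNIV \<Otimes>\<^sub>M borel)"
  unfolding profile_law_eq using sets_agent
  by (metis lessThan_iff measurable_cong_sets measurable_component_singleton)

lemma measurable_win_chance [measurable]:
  assumes "i < N"
  shows "(\<lambda>a. win_chance N a i) \<in> borel_measurable PL"
proof -
  have top [measurable]: "Measurable.pred PL (\<lambda>a. j \<in> top_bidders N a)" for j
  proof (cases "j < N")
    case True
    have "(\<lambda>a. j \<in> top_bidders N a) =
        (\<lambda>a. fst (a j) \<and> (\<forall>k\<in>{..<N}. fst (a k) \<longrightarrow> snd (a k) \<le> snd (a j)))"
      using True by (auto simp: top_bidders_def)
    also have "Measurable.pred PL \<dots>"
    proof (intro pred_intros_logic pred_intros_finite)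
      show "Measurable.pred PL (\<lambda>a. fst (a j))"
        by (rule measurable_compose[OF measurable_agent[OF True] measurable_fst])
      fix k assume "k \<in> {..<N}"
      then have [simp]: "k < N" "j < N" using True by auto
      show "Measurable.pred PL (\<lambda>a. fst (a k))"
        by (rule measurable_compose[OF measurable_agent measurable_fst]) simp
      have "(\<lambda>a. snd (a k)) \<in> borel_measurable PL" "(\<lambda>a. snd (a j)) \<in> borel_measurable PL"
        by (rule measurable_compose[OF measurable_agent measurable_snd], simp)+
      then show "Measurable.pred PL (\<lambda>a. snd (a k) \<le> snd (a j))"
        unfolding not_less[symmetric]
        by (intro pred_intros_logic borel_measurable_pred_less)
    qed simp
    finally show ?thesis .
  qed (simp add: top_bidders_def)
  \<comment> \<open>Written as a finite sum of indicators, the number of top bidders is visibly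
    measurable.\<close>
  have "card (top_bidders N a) = (\<Sum>j<N. of_bool (j \<in> top_bidders N a))" for a
    by (subst sum_of_bool_eq) (auto simp: top_bidders_def intro!: arg_cong[where f=card])
  then have "(\<lambda>a. win_chance N a i) = (\<lambda>a. if i \<in> top_bidders N a
      then 1 / real (\<Sum>j<N. of_bool (j \<in> top_bidders N a)) else 0)"
    by (simp add: win_chance_def fun_eq_iff)
  also have "\<dots> \<in> borel_measurable PL" unfolding of_bool_def by measurable
  finally show ?thesis .
qed

lemma measurable_payoff [measurable]:
  assumes [measurable]: "i < N"
  shows "(\<lambda>a. payoff N V g r1 r2 f a i) \<in> borel_measurable PL"
  unfolding payoff_def using assms by measurable

text \<open>Actions are independent, so a fresh draw of coordinate \<open>i\<close> does not change
  the law. This links equilibrium payoffs to payoffs from fixed deviations.\<close>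

lemma distr_resample:
  assumes "i < N"
  shows "distr (A \<Otimes>\<^sub>M PL) PL (\<lambda>(x, a). a(i := x)) = PL"
  using distr_pair_PiM_eq_PiM[of "{..<N}" "\<lambda>_. A" i] assms prob_space_agent
  by (simp add: profile_law_eq insert_absorb)

lemma measurable_resample [measurable]:
  assumes "i < N"
  shows "(\<lambda>(x, a). a(i := x)) \<in> measurable (A \<Otimes>\<^sub>M PL) PL"
  unfolding profile_law_eq using assms
  by (auto intro!: measurable_fun_upd[where J="{..<N}"] simp: split_beta')

sublocale product_prob_space "\<lambda>_::nat. A" "{..<N}"
  by (rule product_prob_spaceI) (rule prob_space_agent)

section \<open>Winning probability and payoff of a fixed bid\<close>

definition win_prob :: "real \<Rightarrow> real" where
  "win_prob b = (p + (1 - p) * cdf D b) ^ (N - 1)"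

definition interim_payoff :: "real \<Rightarrow> real \<Rightarrow> real \<Rightarrow> real \<Rightarrow> real \<Rightarrow> real \<Rightarrow> real" where
  "interim_payoff V g r1 r2 f b =
     (V - g - b) * win_prob b - (r1 * g + r2 * b) * (1 - win_prob b) - f"

lemma AE_no_tie: "AE a in PL. \<forall>j\<in>{..<N}. snd (a j) \<noteq> b"
proof (rule eventually_ball_finite)
  show "\<forall>j\<in>{..<N}. AE a in PL. snd (a j) \<noteq> b"
    unfolding profile_law_eq
    by (intro ballI AE_PiM_component[where P="\<lambda>z. snd z \<noteq> b"] prob_space_agent AE_agent_no_tie)
qed simp

lemma integrable_win_chance:
  assumes [measurable]: "i < N"
  shows "integrable PL (\<lambda>a. win_chance N (a(i := x)) i)"
    and "integrable PL (\<lambda>a. win_chance N a i)"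
  using assms win_chance_bounds by (auto intro!: PL.integrable_const_bound[where B=1])

text \<open>Ties are null events, so \<open>b\<close> wins exactly when no rival outbids it;
  independence of the rivals turns this into a power.\<close>

lemma integral_win_chance:
  assumes i: "i < N"
  shows "(LINT a|PL. win_chance N (a(i := (True, b))) i) = win_prob b"
proof -
  define S where "S = {a \<in> space PL. \<forall>j\<in>{..<N} - {i}. a j \<in> {z. fst z \<longrightarrow> snd z \<le> b}}"
  have meas: "{z. fst z \<longrightarrow> snd z \<le> b} \<in> sets A"
  proof -
    have "{z::action. fst z \<longrightarrow> snd z \<le> b} = {False} \<times> UNIV \<union> {True} \<times> {..b}" by auto
    then show ?thesis by (auto simp: sets_agent)
  qed
  have S: "S \<in> sets PL"
    unfolding S_def profile_law_eq using meas by measurable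
  have "(LINT a|PL. win_chance N (a(i := (True, b))) i) = (LINT a|PL. indicator S a)"
  proof (rule integral_cong_AE)
    have "AE a in PL. a \<in> space PL" by simp
    with AE_no_tie[of b]
    show "AE a in PL. win_chance N (a(i := (True, b))) i = indicator S a"
      by eventually_elim (simp add: win_chance_no_tie[OF i] S_def indicator_def)
  qed (use i S in measurable)
  also have "\<dots> = measure PL S" using S by simp
  also have "\<dots> = win_prob b"
  proof -
    \<comment> \<open>Coordinate \<open>i\<close> is unconstrained in \<open>S\<close>, which is why
      the exponent is \<open>N - 1\<close>.\<close>
    have "emeasure PL S = (\<Prod>j\<in>{..<N} - {i}. emeasure A {z. fst z \<longrightarrow> snd z \<le> b})"
      unfolding S_def profile_law_eq by (rule emeasure_PiM_Collect) (use meas in auto)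
    also have "\<dots> = ennreal (win_prob b)"
      using i p_bounds D.cdf_nonneg[of b]
      by (simp add: pair_AP.M1.emeasure_eq_measure measure_not_above ennreal_power win_prob_def
          del: ennreal_plus)
    finally show ?thesis
      using p_bounds D.cdf_nonneg[of b] by (simp add: measure_def win_prob_def)
  qed
  finally show ?thesis .
qed

text \<open>For a fixed bid the payoff is affine in the winning chance, so taking expectations just
  replaces that chance by \<open>win_prob b\<close>.\<close>

lemma integral_payoff_bid:
  assumes "i < N"
  shows "(LINT a|PL. payoff N V g r1 r2 f (a(i := (True, b))) i) = interim_payoff V g r1 r2 f b"
proof -
  have "(LINT a|PL. payoff N V g r1 r2 f (a(i := (True, b))) i) =
      (LINT a|PL. (V - g - b + r1 * g + r2 * b) * win_chance N (a(i := (True, b))) i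
        - (r1 * g + r2 * b + f))"
    by (rule Bochner_Integration.integral_cong) (auto simp: payoff_def algebra_simps)
  also have "\<dots> = (V - g - b + r1 * g + r2 * b) * win_prob b - (r1 * g + r2 * b + f)"
    using assms by (simp add: integrable_win_chance integral_win_chance PL.prob_space)
  finally show ?thesis by (simp add: interim_payoff_def algebra_simps)
qed

lemma integral_payoff_abstain:
  "(LINT a|PL. payoff N V g r1 r2 f (a(i := (False, b))) i) = 0"
  by (simp add: payoff_def)

lemma integral_payoff_deviate:
  assumes "i < N"
  shows "(LINT a|PL. payoff N V g r1 r2 f (a(i := x)) i) =
    (if fst x then interim_payoff V g r1 r2 f (snd x) else 0)"
  using integral_payoff_bid[OF assms] integral_payoff_abstain
  by (cases x; cases "fst x") auto

text \<open>Resample the action of agent \<open>i\<close>. Averaging over the profile first gives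
  the deviation payoff \<open>W\<close>, and Fubini over participation and bid leaves the factor
  \<open>1 - p\<close>.\<close>

lemma
  assumes i: "i < N" and int: "integrable PL (\<lambda>a. payoff N V g r1 r2 f a i)"
  shows integrable_interim: "p < 1 \<Longrightarrow> integrable D (interim_payoff V g r1 r2 f)"
    and integral_payoff: "(LINT a|PL. payoff N V g r1 r2 f a i) =
      (1 - p) * (LINT b|D. interim_payoff V g r1 r2 f b)"
proof -
  define W where "W = (\<lambda>x. if fst x then interim_payoff V g r1 r2 f (snd x) else 0)"
  note [measurable] = measurable_resample[OF i] measurable_payoff[OF i]
  have int': "integrable (A \<Otimes>\<^sub>M PL) (\<lambda>(x, a). payoff N V g r1 r2 f (a(i := x)) i)"
    using int by (subst (asm) distr_resample[OF i, symmetric], subst (asm) integrable_distr_eq)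
      (auto simp: split_beta')
  have W: "(LINT a|PL. payoff N V g r1 r2 f (a(i := x)) i) = W x" for x
    using integral_payoff_deviate[OF i] by (simp add: W_def)
  have intW: "integrable (measure_pmf (bernoulli_pmf (1 - p)) \<Otimes>\<^sub>M D) W"
    using pair_AP.integrable_fst'[OF int'] W by (simp add: agent_law_def)
  have "(LINT a|PL. payoff N V g r1 r2 f a i) =
      (LINT z|(A \<Otimes>\<^sub>M PL). (case z of (x, a) \<Rightarrow> payoff N V g r1 r2 f (a(i := x)) i))"
    by (subst distr_resample[OF i, symmetric], subst integral_distr) (auto simp: split_beta')
  also have "\<dots> = (LINT x|A. W x)"
    using pair_AP.integral_fst'[OF int'] W by simp
  also have "\<dots> = (LINT x|measure_pmf (bernoulli_pmf (1 - p)). LINT b|D. W (x, b))"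
    unfolding agent_law_def using P.integral_fst'[OF intW] by simp
  also have "\<dots> = (1 - p) * (LINT b|D. interim_payoff V g r1 r2 f b)"
    using p_bounds by (simp add: W_def)
  finally show "(LINT a|PL. payoff N V g r1 r2 f a i) =
      (1 - p) * (LINT b|D. interim_payoff V g r1 r2 f b)" .
  show "integrable D (interim_payoff V g r1 r2 f)" if "p < 1"
  proof -
    \<comment> \<open>Fubini yields integrable fibres only almost everywhere; participation must
      have positive mass for its fibre to be covered.\<close>
    have "True \<in> set_pmf (bernoulli_pmf (1 - p))"
      using that p_bounds by (simp add: set_pmf_iff)
    then have "integrable D (\<lambda>b. W (True, b))"
      using P.AE_integrable_fst'[OF intW] by (simp add: AE_measure_pmf_iff)
    then show ?thesis by (simp add: W_def)
  qed
qed

subsection \<open>Equilibrium abstention probability and revenue\<close>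

lemma win_prob_0: "win_prob 0 = p ^ (N - 1)"
  by (simp add: win_prob_def cdf_eq_0)

lemma win_prob_bounds: "0 \<le> win_prob b" "win_prob b \<le> 1"
proof -
  have "p + (1 - p) * cdf D b \<le> p + (1 - p) * 1"
    using p_bounds D.cdf_bounded_prob by (intro add_left_mono mult_left_mono) auto
  then show "0 \<le> win_prob b" "win_prob b \<le> 1"
    using p_bounds D.cdf_nonneg[of b] unfolding win_prob_def
    by (auto intro!: power_le_one zero_le_power)
qed

lemma AE_bid_nonneg: "AE b in D. 0 \<le> b"
proof (rule AE_I)
  show "{b \<in> space D. \<not> 0 \<le> b} \<subseteq> {..<0}" by auto
  show "emeasure D {..<0} = 0"
    using mixed by (simp add: mixed_strategy_def D.emeasure_eq_measure)
qed simp

text \<open>By continuity the cdf takes the value \<open>x\<close> at some \<open>m'\<close>. The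
  bids up to \<open>m'\<close> then have positive mass \<open>x\<close>, so they cannot all lie in
  the null set where \<open>Q\<close> fails.\<close>

lemma AE_imp_low_bid:
  assumes "AE b in D. Q b" and "0 < x" and "x < 1"
  obtains b where "Q b" and "0 \<le> b" and "cdf D b \<le> x"
proof -
  have "\<forall>\<^sub>F b in at_top. x < cdf D b"
    using D.cdf_lim_at_top_prob \<open>x < 1\<close> by (rule order_tendstoD)
  moreover have "\<forall>\<^sub>F b::real in at_top. 0 \<le> b" by (rule eventually_ge_at_top)
  ultimately have "\<forall>\<^sub>F b in at_top. x < cdf D b \<and> 0 \<le> b" by eventually_elim simp
  then obtain m where "x < cdf D m" "0 \<le> m"
    using eventually_happens'[OF trivial_limit_at_top_linorder] by blast
  moreover have "continuous_on {0..m} (cdf D)"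
    using mixed by (auto simp: mixed_strategy_def intro: continuous_on_subset)
  ultimately obtain m' where m': "cdf D m' = x"
    using IVT'[of "cdf D" 0 x m] cdf_eq_0 \<open>0 < x\<close> by auto
  have *: "AE b in D. Q b \<and> 0 \<le> b" using assms(1) AE_bid_nonneg by eventually_elim simp
  have "\<exists>b. Q b \<and> 0 \<le> b \<and> b \<le> m'"
  proof (rule ccontr)
    assume "\<not> ?thesis"
    then have low: "Q b \<and> 0 \<le> b \<longrightarrow> b \<notin> {..m'}" for b by auto
    have "AE b in D. b \<notin> {..m'}" by (rule AE_mp[OF * AE_I2]) (rule low)
    then have "measure D {..m'} = 0" by (subst D.prob_eq_0) auto
    then show False using m' \<open>0 < x\<close> by (simp add: cdf_def)
  qed
  then show thesis using that m' D.cdf_nondecreasing by metis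
qed

lemma
  assumes N: "2 \<le> N" and par: "0 < g" "g < V" "0 \<le> r1" "0 \<le> r2" "0 \<le> f" "f < V - g"
    and eq: "symmetric_equilibrium N V g r1 r2 f p D"
  shows equilibrium_abstention: "p ^ (N - 1) * (V - g + r1 * g) = r1 * g + f"
    and equilibrium_payoff: "i < N \<Longrightarrow> (LINT a|PL. payoff N V g r1 r2 f a i) = 0"
proof -
  \<comment> \<open>\<open>J\<close> is the payoff conditional on participating. \<open>k x\<close>
    bounds \<open>U b\<close> for nonnegative bids with \<open>cdf D b\<close> at most
    \<open>x\<close>: it drops the terms proportional to the bid and is exact at the bid 0.\<close>
  define U where "U = interim_payoff V g r1 r2 f"
  define J where "J = (LINT b|D. U b)"
  define k where "k = (\<lambda>x. (V - g + r1 * g) * (p + (1 - p) * x) ^ (N - 1) - (r1 * g + f))"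
  have int: "integrable PL (\<lambda>a. payoff N V g r1 r2 f a i)"
    and dev: "fst x \<longrightarrow> 0 \<le> snd x \<Longrightarrow> (LINT a|PL. payoff N V g r1 r2 f (a(i := x)) i)
           \<le> (LINT a|PL. payoff N V g r1 r2 f a i)" if "i < N" for i x
    using eq that by (cases x, simp_all add: symmetric_equilibrium_def)+
  have payoff: "(LINT a|PL. payoff N V g r1 r2 f a i) = (1 - p) * J" if "i < N" for i
    using integral_payoff[OF that int[OF that]] by (simp add: J_def U_def)
  have "0 < N" using N by simp
  have U_le: "U b \<le> (1 - p) * J" if "0 \<le> b" for b
    using dev[OF \<open>0 < N\<close>, of "(True, b)"] that payoff[OF \<open>0 < N\<close>]
    by (simp add: integral_payoff_bid[OF \<open>0 < N\<close>] U_def)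
  have J_ge: "0 \<le> (1 - p) * J"
    using dev[OF \<open>0 < N\<close>, of "(False, 0)"] payoff[OF \<open>0 < N\<close>]
    by (simp add: integral_payoff_abstain)
  have U0: "U 0 = k 0"
    by (simp add: U_def interim_payoff_def win_prob_0 k_def algebra_simps)
  \<comment> \<open>If everybody surely abstained, the bid 0 would win alone and earn
    \<open>V - g - f\<close>, which is positive.\<close>
  have "p < 1"
  proof (rule ccontr)
    assume "\<not> p < 1"
    then have "p = 1" using p_bounds by simp
    then have "U 0 = V - g - f" "U 0 \<le> 0" using U0 U_le[of 0] by (auto simp: k_def)
    then show False using par by simp
  qed
  then have intU: "integrable D U"
    using integrable_interim[OF \<open>0 < N\<close> int[OF \<open>0 < N\<close>]] by (simp add: U_def)
  \<comment> \<open>Averaging the no-deviation bound over \<open>D\<close> gives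
    \<open>p * J \<le> 0\<close>; as \<open>J\<close> is nonnegative, it can be positive only if
    \<open>p = 0\<close>.\<close>
  have "J \<le> (LINT b|D. (1 - p) * J)"
    unfolding J_def
  proof (rule integral_mono_AE[OF intU])
    show "AE b in D. U b \<le> (1 - p) * (LINT b|D. U b)"
      using AE_bid_nonneg by eventually_elim (use U_le J_def in auto)
  qed simp
  then have "p * J \<le> 0" using D.prob_space by (simp add: algebra_simps)
  moreover have "0 \<le> J" using J_ge \<open>p < 1\<close> by (simp add: zero_le_mult_iff)
  ultimately have pJ: "p * J = 0" using p_bounds by (intro antisym mult_nonneg_nonneg) auto
  then have J_eq: "(1 - p) * J = J" by (simp add: algebra_simps)
  \<comment> \<open>A nonnegative gap with mean zero vanishes almost everywhere: almost every
    equilibrium bid earns exactly \<open>J\<close>.\<close>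
  have "(LINT b|D. J - U b) = 0"
    using intU D.prob_space by (simp add: J_def)
  moreover have "AE b in D. 0 \<le> J - U b"
    using AE_bid_nonneg by eventually_elim (use U_le J_eq in auto)
  ultimately have AE_J: "AE b in D. J - U b = 0"
    using integral_nonneg_eq_0_iff_AE[of D "\<lambda>b. J - U b"] intU by simp
  have J_le: "J \<le> k x" if x: "0 < x" "x < 1" for x
  proof -
    obtain b where b: "J - U b = 0" "0 \<le> b" "cdf D b \<le> x"
      using AE_imp_low_bid[OF AE_J x] .
    have "U b = (V - g + r1 * g) * win_prob b - (r1 * g + f)
        - b * (win_prob b + r2 * (1 - win_prob b))"
      by (simp add: U_def interim_payoff_def algebra_simps)
    also have "\<dots> \<le> (V - g + r1 * g) * win_prob b - (r1 * g + f)"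
      using b par win_prob_bounds[of b] by simp
    also have "\<dots> \<le> k x"
      unfolding k_def win_prob_def using b par p_bounds D.cdf_nonneg[of b]
      by (intro diff_right_mono mult_left_mono power_mono add_left_mono) auto
    finally show ?thesis using b by simp
  qed
  \<comment> \<open>Letting the quantile tend to 0 closes the chain
    \<open>J \<le> k 0 = U 0 \<le> J\<close>, so the bid 0 earns \<open>J\<close> although
    \<open>D\<close> has no atom there.\<close>
  have "(k \<longlongrightarrow> k 0) (at_right 0)"
    unfolding k_def by (auto intro!: tendsto_eq_intros)
  then have "J \<le> k 0"
  proof (rule tendsto_lowerbound)
    have "\<forall>\<^sub>F x::real in at_right 0. x \<in> {0<..<1}"
      by (rule eventually_at_right_real) simp
    then show "\<forall>\<^sub>F x in at_right 0. J \<le> k x" by eventually_elim (use J_le in auto)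
  qed simp
  with U_le[of 0] J_eq U0 have k0: "k 0 = J" by simp
  \<comment> \<open>If nobody ever abstains, the bid 0 never wins (\<open>N - 1\<close> is positive)
    and its payoff \<open>k 0\<close> is at most 0.\<close>
  have "J = 0"
  proof (cases "p = 0")
    case True
    then have "k 0 = - (r1 * g + f)" using N by (simp add: k_def)
    moreover have "0 \<le> r1 * g" using par by simp
    ultimately show ?thesis using k0 \<open>0 \<le> J\<close> par by linarith
  qed (use pJ in simp)
  then show "p ^ (N - 1) * (V - g + r1 * g) = r1 * g + f"
    using k0 by (simp add: k_def mult.commute)
  show "(LINT a|PL. payoff N V g r1 r2 f a i) = 0" if "i < N"
    using payoff[OF that] \<open>J = 0\<close> by simp
qed

section \<open>Expected participation, allocation and revenue\<close>

lemma measure_participates: "measure A {z. fst z} = 1 - p" "measure A {z. \<not> fst z} = p"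
proof -
  have "{z::action. fst z} = {True} \<times> UNIV" "{z::action. \<not> fst z} = {False} \<times> UNIV" by auto
  then show "measure A {z. fst z} = 1 - p" "measure A {z. \<not> fst z} = p"
    unfolding measure_def agent_law_def using p_bounds D.emeasure_space_1
    by (auto simp: D.emeasure_pair_measure_Times emeasure_pmf_single)
qed

lemma sets_participates: "{z. fst z} \<in> sets A" "{z. \<not> fst z} \<in> sets A"
proof -
  have "{z::action. fst z} = {True} \<times> UNIV" "{z::action. \<not> fst z} = {False} \<times> UNIV" by auto
  then show "{z. fst z} \<in> sets A" "{z. \<not> fst z} \<in> sets A" by (auto simp: sets_agent)
qed

text \<open>The object is allocated unless all \<open>N\<close> independent agents abstain.\<close>

lemma integral_sum_win_chance: "(\<Sum>i<N. LINT a|PL. win_chance N a i) = 1 - p ^ N"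
proof -
  define S where "S = {a \<in> space PL. \<forall>i\<in>{..<N}. a i \<in> {z. \<not> fst z}}"
  have S: "S \<in> sets PL"
    unfolding S_def profile_law_eq using sets_participates by measurable
  have "(\<Sum>i<N. LINT a|PL. win_chance N a i) = (LINT a|PL. (\<Sum>i<N. win_chance N a i))"
    by (simp add: integrable_win_chance)
  also have "\<dots> = (LINT a|PL. 1 - indicator S a)"
    by (rule Bochner_Integration.integral_cong) (auto simp: sum_win_chance S_def indicator_def)
  also have "\<dots> = 1 - measure PL S"
  proof -
    have "integrable PL (indicator S :: _ \<Rightarrow> real)"
      by (rule integrable_real_indicator[OF S]) (simp add: PL.emeasure_eq_measure)
    then show ?thesis using S PL.prob_space by simp
  qed
  also have "emeasure PL S = (\<Prod>i\<in>{..<N}. emeasure A {z. \<not> fst z})"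
    unfolding S_def profile_law_eq by (rule emeasure_PiM_Collect) (use sets_participates in auto)
  then have "emeasure PL S = ennreal (p ^ N)"
    using p_bounds by (simp add: pair_AP.M1.emeasure_eq_measure measure_participates ennreal_power)
  then have "measure PL S = p ^ N"
    using p_bounds by (simp add: measure_def)
  finally show ?thesis .
qed

text \<open>Agents keep nothing in expectation, so by \<open>payment_eq\<close> the sequencer
  receives the whole value of the allocated object.\<close>

lemma equilibrium_revenue:
  assumes "2 \<le> N" "0 < g" "g < V" "0 \<le> r1" "0 \<le> r2" "0 \<le> f" "f < V - g"
    and "symmetric_equilibrium N V g r1 r2 f p D"
  shows "expected_revenue N g r1 r2 f p D = (1 - p ^ N) * V"
proof -
  have [simp]: "integrable PL (\<lambda>a. payoff N V g r1 r2 f a i)" if "i < N" for i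
    using assms(8) that by (auto simp: symmetric_equilibrium_def)
  have "expected_revenue N g r1 r2 f p D =
      (\<Sum>i<N. V * (LINT a|PL. win_chance N a i) - (LINT a|PL. payoff N V g r1 r2 f a i))"
    unfolding expected_revenue_def payment_eq[where V=V] by (simp add: integrable_win_chance)
  also have "\<dots> = V * (\<Sum>i<N. LINT a|PL. win_chance N a i)"
    using equilibrium_payoff[OF assms] by (simp add: sum_distrib_left)
  finally show ?thesis by (simp add: integral_sum_win_chance)
qed

lemma expected_submissions_eq: "expected_submissions N p D = N * (1 - p)"
proof -
  have prob: "measure PL {a \<in> space PL. fst (a i)} = 1 - p" if "i < N" for i
  proof -
    have "emeasure PL {a \<in> space PL. a i \<in> {z. fst z}} = emeasure A {z. fst z}"
      unfolding profile_law_eq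
      by (rule emeasure_PiM_Collect_single) (use sets_participates that in auto)
    then show ?thesis by (simp add: measure_def measure_participates(1)[unfolded measure_def])
  qed
  have "real (card {i. i < N \<and> fst (a i)}) = (\<Sum>i<N. indicator {a \<in> space PL. fst (a i)} a)"
    if "a \<in> space PL" for a
    using that by (simp add: indicator_def sum.If_cases Int_def)
  then have "expected_submissions N p D =
      (LINT a|PL. (\<Sum>i<N. indicator {a \<in> space PL. fst (a i)} a))"
    unfolding expected_submissions_def by (intro Bochner_Integration.integral_cong) auto
  also have "\<dots> = (\<Sum>i<N. LINT a|PL. indicator {a \<in> space PL. fst (a i)} a)"
    by (intro Bochner_Integration.integral_sum integrable_real_indicator)
      (auto simp: PL.emeasure_eq_measure)
  also have "\<dots> = (\<Sum>i<N. 1 - p)"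
    by (intro sum.cong) (auto simp: prob)
  finally show ?thesis by simp
qed

subsection \<open>Existence of equilibria\<close>

text \<open>Bounded bids make the payoff almost surely bounded, which supplies the integrability
  demanded by \<open>symmetric_equilibrium\<close>.\<close>

lemma integrable_payoff_bounded:
  assumes i: "i < N" and bdd: "AE b in D. b \<in> {0..m}"
  shows "integrable PL (\<lambda>a. payoff N V g r1 r2 f a i)"
proof (rule PL.integrable_const_bound)
  have "AE a in PL. snd (a i) \<in> {0..m}"
    unfolding profile_law_eq using i bdd
    by (intro AE_PiM_component[where P="\<lambda>z. snd z \<in> {0..m}"] prob_space_agent AE_agent_bid) auto
  then show "AE a in PL. norm (payoff N V g r1 r2 f a i)
      \<le> \<bar>V - g\<bar> + m + (\<bar>r1 * g\<bar> + \<bar>r2\<bar> * m) + \<bar>f\<bar>"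
  proof eventually_elim
    case (elim a)
    define w b where "w = win_chance N a i" and "b = snd (a i)"
    have w: "0 \<le> w" "w \<le> 1" by (simp_all add: w_def win_chance_bounds)
    have b: "0 \<le> b" "b \<le> m" using elim by (auto simp: b_def)
    have "\<bar>(V - g - b) * w\<bar> \<le> \<bar>V - g - b\<bar>"
      using w by (simp add: abs_mult mult_left_le)
    also have "\<dots> \<le> \<bar>V - g\<bar> + m" using b by linarith
    finally have 1: "\<bar>(V - g - b) * w\<bar> \<le> \<bar>V - g\<bar> + m" .
    have "\<bar>(r1 * g + r2 * b) * (1 - w)\<bar> \<le> \<bar>r1 * g + r2 * b\<bar>"
      using w by (simp add: abs_mult mult_left_le)
    also have "\<dots> \<le> \<bar>r1 * g\<bar> + \<bar>r2\<bar> * m"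
      using b by (intro order_trans[OF abs_triangle_ineq] add_left_mono)
        (simp add: abs_mult mult_left_mono)
    finally have 2: "\<bar>(r1 * g + r2 * b) * (1 - w)\<bar> \<le> \<bar>r1 * g\<bar> + \<bar>r2\<bar> * m" .
    have "payoff N V g r1 r2 f a i =
        (if fst (a i) then (V - g - b) * w - (r1 * g + r2 * b) * (1 - w) - f else 0)"
      by (simp add: payoff_def w_def b_def)
    also have "\<bar>\<dots>\<bar> \<le> \<bar>(V - g - b) * w\<bar> + \<bar>(r1 * g + r2 * b) * (1 - w)\<bar> + \<bar>f\<bar>"
      by (simp add: abs_triangle_ineq4[THEN order_trans])
    finally show ?case using 1 2 unfolding real_norm_def by linarith
  qed
qed (rule measurable_payoff[OF i])

text \<open>Almost all bids drawn earn 0, as abstaining does, and no other nonnegative bid earns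
  more.\<close>

lemma equilibriumI:
  assumes "AE b in D. b \<in> {0..m}"
    and "\<And>b. b \<in> {0..m} \<Longrightarrow> interim_payoff V g r1 r2 f b = 0"
    and "\<And>b. m < b \<Longrightarrow> interim_payoff V g r1 r2 f b \<le> 0"
  shows "symmetric_equilibrium N V g r1 r2 f p D"
proof -
  have "(LINT b|D. interim_payoff V g r1 r2 f b) = (LINT b|D. 0)"
  proof (rule integral_cong_AE)
    show "interim_payoff V g r1 r2 f \<in> borel_measurable D"
    proof -
      have [measurable]: "cdf D \<in> borel_measurable D"
        using mixed
        by (intro D.measurable_finite_borel borel_measurable_continuous_onI) (simp add: mixed_strategy_def)
      show ?thesis unfolding interim_payoff_def win_prob_def by measurable
    qed
    show "AE b in D. interim_payoff V g r1 r2 f b = 0"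
      using assms(1) by eventually_elim (rule assms(2))
  qed simp
  moreover have "interim_payoff V g r1 r2 f b \<le> 0" if "0 \<le> b" for b
    using assms(2,3)[of b] that by (cases "b \<le> m") auto
  ultimately show ?thesis
    unfolding symmetric_equilibrium_def using mixed integrable_payoff_bounded[OF _ assms(1)]
    by (auto simp: integral_payoff integral_payoff_deviate)
qed

end

text \<open>
  The equilibrium bid law is the distribution of the quantile function at a uniform variable:
  solving the indifference condition for the bid at which the winning probability is
  \<open>y = (p + (1 - p) v) ^ (N - 1)\<close> gives \<open>Q v\<close> explicitly.
\<close>

lemma ex_symmetric_equilibrium:
  assumes N: "2 \<le> N" and par: "0 < g" "g < V" "0 \<le> r1" "0 \<le> r2" "r2 \<le> 1" "0 \<le> f" "f < V - g"
    and pos: "0 < r1 * g + f"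
  shows "\<exists>p D. symmetric_equilibrium N V g r1 r2 f p D"
proof -
  \<comment> \<open>With winning probability \<open>y\<close>, a bid \<open>b\<close> earns zero
    when \<open>A * y - B = b * (y + (1 - y) * r2)\<close>. At \<open>b = 0\<close> this forces
    \<open>y = B / A\<close>, which determines \<open>p\<close>.\<close>
  define A B where "A = V - g + r1 * g" and "B = r1 * g + f"
  have AB: "0 < B" "B < A" using pos par by (auto simp: A_def B_def)
  define p where "p = root (N - 1) (B / A)"
  have "0 < N - 1" using N by simp
  have p: "0 < p" "p < 1" "p ^ (N - 1) = B / A"
    using AB N by (auto simp: p_def)
  define y where "y = (\<lambda>v. (p + (1 - p) * v) ^ (N - 1))"
  define Q where "Q = (\<lambda>v. (A * y v - B) / (y v + (1 - y v) * r2))"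
  \<comment> \<open>The highest bid: winning for sure, it leaves no surplus.\<close>
  define m where "m = V - g - f"
  have y01: "y 0 = B / A" "y 1 = 1" using p by (auto simp: y_def)
  have y_less: "y u < y v" if "0 \<le> u" "u < v" for u v
    unfolding y_def using that p \<open>0 < N - 1\<close>
    by (intro power_strict_mono add_strict_left_mono mult_strict_left_mono) auto
  have y_pos: "0 < y v" if "0 \<le> v" for v
    unfolding y_def using that p by (intro zero_less_power add_pos_nonneg) auto
  have y_le: "y v \<le> 1" if "v \<in> {0..1}" for v
    using y_less[of v 1] y01 that by (cases "v = 1") auto
  \<comment> \<open>Positivity of \<open>B\<close> makes \<open>p\<close>, and hence
    \<open>y\<close>, positive; this keeps the denominator positive even when
    \<open>r2 = 0\<close>.\<close>
  have den: "0 < y v + (1 - y v) * r2" if "v \<in> {0..1}" for v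
    using y_pos[of v] y_le[OF that] that par by (intro add_pos_nonneg) auto
  have Q01: "Q 0 = 0" "Q 1 = m"
    using AB by (auto simp: Q_def y01 m_def A_def B_def)
  have Q_less: "Q u < Q v" if "u \<in> {0..1}" "v \<in> {0..1}" "u < v" for u v
  proof -
    \<comment> \<open>This product is the numerator of \<open>Q v - Q u\<close> over the common
      denominator.\<close>
    have "0 < (y v - y u) * (A * r2 + B * (1 - r2))"
    proof (rule mult_pos_pos)
      show "0 < y v - y u" using y_less that by auto
      have "0 < B" by fact
      also have "B = B * r2 + B * (1 - r2)" by (simp add: algebra_simps)
      also have "\<dots> \<le> A * r2 + B * (1 - r2)"
        using AB par by (intro add_right_mono mult_right_mono) auto
      finally show "0 < A * r2 + B * (1 - r2)" .
    qed
    then have "(A * y u - B) * (y v + (1 - y v) * r2) < (A * y v - B) * (y u + (1 - y u) * r2)"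
      by (simp add: algebra_simps)
    then show ?thesis
      unfolding Q_def using den[OF that(1)] den[OF that(2)] by (simp add: divide_less_eq less_divide_eq
        pos_divide_less_eq pos_less_divide_eq)
  qed
  then have Q_le_iff: "Q u \<le> Q v \<longleftrightarrow> u \<le> v" if "u \<in> {0..1}" "v \<in> {0..1}" for u v
    using that by (metis less_eq_real_def linorder_not_le)
  have Q_range: "Q v \<in> {0..m}" if "v \<in> {0..1}" for v
    using Q_le_iff[of 0 v] Q_le_iff[of v 1] that Q01 by auto
  have Q_cont: "continuous_on {0..1} Q"
    unfolding Q_def using den unfolding y_def
    by (intro continuous_intros) force
  have Q_onto: "\<exists>v\<in>{0..1}. Q v = b" if "b \<in> {0..m}" for b
    using IVT'[of Q 0 b 1] Q_cont that Q01 by auto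
  have Q_meas [measurable]: "Q \<in> borel_measurable lborel"
    unfolding Q_def y_def by measurable
  define L where "L = uniform_measure lborel {0..1::real}"
  interpret L: prob_space L
    unfolding L_def by (rule prob_space_uniform_measure) auto
  have Q_meas' [measurable]: "Q \<in> borel_measurable L"
    unfolding L_def by simp
  define D where "D = distr L borel Q"
  have measure_D: "measure D X = measure lborel ({0..1} \<inter> Q -` X)" if [measurable]: "X \<in> sets borel" for X
  proof -
    have "measure D X = measure L (Q -` X \<inter> space L)"
      unfolding D_def using that by (simp add: measure_distr)
    also have "\<dots> = measure lborel ({0..1} \<inter> (Q -` X \<inter> space lborel))"
      unfolding L_def using measurable_sets[OF Q_meas that]
      by (subst measure_uniform_measure) auto
    finally show ?thesis by simp
  qed
  interpret D: real_distribution D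
    unfolding D_def by (rule L.real_distribution_distr) simp
  \<comment> \<open>\<open>Q\<close> is strictly increasing on the unit interval, so the cdf of its
    law inverts it.\<close>
  have cdf_Q: "cdf D (Q v) = v" if "v \<in> {0..1}" for v
  proof -
    have "{0..1} \<inter> Q -` {..Q v} = {0..v}" using Q_le_iff that by auto
    then show ?thesis using that by (simp add: cdf_def measure_D)
  qed
  have "mixed_strategy p D"
    unfolding mixed_strategy_def
  proof (intro conjI)
    show "continuous_on UNIV (cdf D)"
    proof (rule continuous_at_imp_continuous_on, rule ballI)
      fix b
      \<comment> \<open>Injectivity of \<open>Q\<close> leaves at most one preimage in the unit
        interval, so the law has no atoms and its cdf is continuous.\<close>
      have "{0..1} \<inter> Q -` {b} = {} \<or> (\<exists>v. {0..1} \<inter> Q -` {b} = {v})"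
      proof (cases "\<exists>v\<in>{0..1}. Q v = b")
        case True
        then obtain v where v: "v \<in> {0..1}" "Q v = b" by blast
        have "u = v" if "u \<in> {0..1}" "Q u = b" for u
          using Q_le_iff[OF that(1) v(1)] Q_le_iff[OF v(1) that(1)] that(2) v(2) by auto
        then have "{0..1} \<inter> Q -` {b} = {v}" using v by blast
        then show ?thesis by blast
      qed auto
      then have "measure D {b} = 0" by (subst measure_D) (auto simp: measure_def)
      then show "isCont (cdf D) b" by (simp add: D.isCont_cdf)
    qed
    have "{0..1} \<inter> Q -` {..<0} = {}" using Q_range by force
    then show "measure D {..<0} = 0" by (simp add: measure_D)
  qed (use p D.real_distribution_axioms in auto)
  then interpret S: symmetric_profile N p D by unfold_locales
  have "symmetric_equilibrium N V g r1 r2 f p D"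
  proof (rule S.equilibriumI)
    show "AE b in D. b \<in> {0..m}"
      unfolding D_def L_def using Q_range
      by (subst AE_distr_iff) (auto simp: AE_uniform_measure)
  next
    fix b assume "b \<in> {0..m}"
    then obtain v where v: "v \<in> {0..1}" "Q v = b" using Q_onto by blast
    have "S.win_prob b = y v" using cdf_Q v by (auto simp: S.win_prob_def y_def)
    then have "S.interim_payoff V g r1 r2 f b = A * y v - B - b * (y v + (1 - y v) * r2)"
      by (simp add: S.interim_payoff_def A_def B_def algebra_simps)
    also have "b * (y v + (1 - y v) * r2) = A * y v - B"
      using v den[OF v(1)] by (auto simp: Q_def)
    finally show "S.interim_payoff V g r1 r2 f b = 0" by simp
  next
    fix b assume "m < b"
    then have "1 \<le> cdf D b" using cdf_Q[of 1] D.cdf_nondecreasing[of m b] Q01 by simp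
    then have "cdf D b = 1" using D.cdf_bounded_prob[of b] by simp
    then have "S.interim_payoff V g r1 r2 f b = V - g - b - f"
      by (simp add: S.interim_payoff_def S.win_prob_def)
    then show "S.interim_payoff V g r1 r2 f b \<le> 0" using \<open>m < b\<close> by (simp add: m_def)
  qed
  then show ?thesis by blast
qed

subsection \<open>Comparison of the schemes\<close>

lemma scheme1_equilibriumD:
  assumes "2 \<le> N" "0 < g" "g < V" "0 \<le> r1" "0 \<le> r2"
    and eq: "scheme1_equilibrium N V g r1 r2 p D"
  shows "0 \<le> p" "p ^ (N - 1) * (V - g + r1 * g) = r1 * g"
    "scheme1_profit N g r1 r2 c p D = (1 - p ^ N) * V - c * (N * (1 - p))"
proof -
  have eq': "symmetric_equilibrium N V g r1 r2 0 p D"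
    using eq by (simp add: scheme1_equilibrium_def)
  then interpret symmetric_profile N p D
    by unfold_locales (simp add: symmetric_equilibrium_def)
  show "0 \<le> p" by (rule p_bounds)
  show "p ^ (N - 1) * (V - g + r1 * g) = r1 * g"
    using equilibrium_abstention[OF assms(1-5) _ _ eq'] assms by simp
  show "scheme1_profit N g r1 r2 c p D = (1 - p ^ N) * V - c * (N * (1 - p))"
    using equilibrium_revenue[OF assms(1-5) _ _ eq'] assms
    by (simp add: scheme1_profit_def expected_submissions_eq)
qed

lemma scheme2_equilibriumD:
  assumes "2 \<le> N" "0 < g" "g < V" "0 \<le> r1" "0 \<le> r2" "0 \<le> c" "c < V - g"
    and eq: "scheme2_equilibrium N V g r1 r2 c p D"
  shows "0 \<le> p" "p ^ (N - 1) * (V - g + r1 * g) = r1 * g + c"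
    "scheme2_revenue N g r1 r2 c p D = (1 - p ^ N) * V"
proof -
  have eq': "symmetric_equilibrium N V g r1 r2 c p D"
    using eq by (simp add: scheme2_equilibrium_def)
  then interpret symmetric_profile N p D
    by unfold_locales (simp add: symmetric_equilibrium_def)
  show "0 \<le> p" by (rule p_bounds)
  show "p ^ (N - 1) * (V - g + r1 * g) = r1 * g + c"
    by (rule equilibrium_abstention[OF assms(1-7) eq'])
  show "scheme2_revenue N g r1 r2 c p D = (1 - p ^ N) * V"
    unfolding scheme2_revenue_def by (rule equilibrium_revenue[OF assms(1-7) eq'])
qed

text \<open>Strict convexity of the power function on the nonnegative reals. The induction
  multiplies by \<open>x\<close>, and the new tangent falls below \<open>x\<close> times the old one
  by \<open>n * p ^ (n - 1) * (x - p)\<^sup>2\<close>.\<close>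

lemma power_above_tangent:
  fixes p x :: real
  assumes "0 < p" "0 \<le> x" "x \<noteq> p" "2 \<le> n"
  shows "p ^ n + n * p ^ (n - 1) * (x - p) < x ^ n"
  using assms(4)
proof (induction n rule: dec_induct)
  case base
  have "0 < (x - p)\<^sup>2" using assms by simp
  then show ?case by (simp add: power2_eq_square algebra_simps)
next
  case (step n)
  obtain k where k: "n = Suc k" using step.hyps by (cases n) auto
  have "p ^ Suc n + Suc n * p ^ (Suc n - 1) * (x - p) =
      x * (p ^ n + n * p ^ (n - 1) * (x - p)) - n * p ^ (n - 1) * (x - p)\<^sup>2"
    by (simp add: k power2_eq_square algebra_simps)
  also have "\<dots> < x * (p ^ n + n * p ^ (n - 1) * (x - p))"
    using assms step.hyps by simp
  also have "\<dots> \<le> x * x ^ n"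
    using step.IH assms by (intro mult_left_mono) auto
  finally show ?case by simp
qed

text \<open>Explicit smallness conditions on \<open>c\<close>. \<open>c < g\<close> puts the Scheme
  1 optimum inside the unit interval; \<open>small\<close> makes the cost \<open>c * N\<close>
  exceed what Scheme 2 loses to abstention plus what Scheme 1 saves by it.\<close>

lemma small_cost_comparison:
  fixes N :: nat and V g r2 c :: real
  assumes N: "2 \<le> N" and par: "0 < g" "g < V" "0 \<le> r2" "r2 \<le> 1"
    and c: "0 < c" "c < V - g" "c < g"
    and small: "root (N - 1) (2 * c / (V - g)) * (2 * V / (V - g) + N) < N"
  shows "(\<exists>r1. scheme1_optimal N V g r2 c r1) \<and>
    (\<exists>r1. scheme2_optimal N V g r2 c r1) \<and>
    (\<forall>r1 s1. scheme1_optimal N V g r2 c r1 \<and> (s1 = r1 \<or> scheme2_optimal N V g r2 c s1) \<longrightarrow>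
       (\<exists>p D. scheme2_equilibrium N V g s1 r2 c p D) \<and>
       (\<forall>p D q E. scheme1_equilibrium N V g r1 r2 p D \<and> scheme2_equilibrium N V g s1 r2 c q E \<longrightarrow>
          scheme1_profit N g r1 r2 c p D < scheme2_revenue N g s1 r2 c q E))"
proof -
  have N1: "0 < N - 1" using N by simp
  have pow_N: "x ^ N = x * x ^ (N - 1)" for x :: real
    using N by (cases N) auto
  have pow_le: "x \<le> y" if "x ^ (N - 1) \<le> y ^ (N - 1)" "0 \<le> y" for x y :: real
    using that N1 by (meson not_le power_strict_mono)
  \<comment> \<open>\<open>p0\<close> is the stationary point of the profit \<open>\<phi>\<close>
    below, and \<open>r0\<close> is the rate at which Scheme 1 agents abstain with probability
    \<open>p0\<close>.\<close>
  define p0 where "p0 = root (N - 1) (c / V)"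
  have p0: "0 < p0" "p0 ^ (N - 1) = c / V"
    using c par N1 by (auto simp: p0_def)
  define r0 where "r0 = c * (V - g) / (g * (V - c))"
  have Vc: "0 < V - c" using c par by simp
  have r0g: "r0 * g = c * (V - g) / (V - c)" using par by (simp add: r0_def)
  have "c * V \<le> g * V" using c par by simp
  then have r0: "0 < r0" "r0 \<in> {0..1}" using par c Vc
    by (auto simp: r0_def divide_le_eq algebra_simps)
  have r0_sum: "V - g + r0 * g = (V - g) * V / (V - c)"
    unfolding r0g using Vc by (simp add: field_simps)
  define \<phi> where "\<phi> = (\<lambda>x::real. (1 - x ^ N) * V - c * (N * (1 - x)))"
  \<comment> \<open>At \<open>p0\<close> the tangent of \<open>V * x ^ N\<close> has slope
    \<open>c * N\<close>, which cancels the linear submission cost; strict convexity does the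
    rest.\<close>
  have \<phi>_less: "\<phi> x < \<phi> p0" if "0 \<le> x" "x \<noteq> p0" for x
  proof -
    have "V * (p0 ^ N + N * (c / V) * (x - p0)) < V * x ^ N"
      using power_above_tangent[OF p0(1) that N] p0(2) par by simp
    also have "V * (p0 ^ N + N * (c / V) * (x - p0)) = V * p0 ^ N + c * N * (x - p0)"
      using par by (simp add: field_simps)
    finally show ?thesis by (simp add: \<phi>_def algebra_simps)
  qed
  \<comment> \<open>This transfers the unique maximiser from abstention probabilities to penalty
    rates.\<close>
  have p_iff: "p = p0 \<longleftrightarrow> r = r0"
    if "0 \<le> p" "p ^ (N - 1) * (V - g + r * g) = r * g" "0 \<le> r" for p r
  proof -
    have pos: "0 < V - g + r * g" using par that by (simp add: add_pos_nonneg)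
    have "p = p0 \<longleftrightarrow> p ^ (N - 1) = p0 ^ (N - 1)"
      using that p0 N1 by (metis less_eq_real_def power_eq_imp_eq_base)
    also have "p ^ (N - 1) = r * g / (V - g + r * g)"
      using that(2) pos by (simp add: field_simps)
    also have "\<dots> = p0 ^ (N - 1) \<longleftrightarrow> r * (g * (V - c)) = c * (V - g)"
      unfolding p0(2) using pos par by (simp add: field_simps)
    also have "\<dots> \<longleftrightarrow> r = r0"
      unfolding r0_def using par Vc by (simp add: eq_divide_eq)
    finally show ?thesis .
  qed
  have S1: "0 \<le> p" "p = p0 \<longleftrightarrow> r = r0" "scheme1_profit N g r r2 c p D = \<phi> p"
    if "scheme1_equilibrium N V g r r2 p D" "r \<in> {0..1}" for r p D
    using scheme1_equilibriumD[OF N par(1,2) _ par(3) that(1)] that(2) p_iff by (auto simp: \<phi>_def)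
  have ex1: "\<exists>p D. scheme1_equilibrium N V g r0 r2 p D"
    unfolding scheme1_equilibrium_def
    using r0 par by (intro ex_symmetric_equilibrium[OF N]) auto
  \<comment> \<open>The upfront fee \<open>c\<close> is positive, so an equilibrium exists at every
    rate, including \<open>r = 0\<close>.\<close>
  have ex2: "\<exists>p D. scheme2_equilibrium N V g r r2 c p D" if "r \<in> {0..1}" for r
    unfolding scheme2_equilibrium_def
    using that c par by (intro ex_symmetric_equilibrium[OF N]) (auto intro: add_nonneg_pos)
  have opt_r0: "scheme1_optimal N V g r2 c r0"
    unfolding scheme1_optimal_def
  proof (intro conjI allI impI; (elim conjE)?)
    fix p D r' p' D'
    assume *: "scheme1_equilibrium N V g r0 r2 p D" "r' \<in> {0..1}" "scheme1_equilibrium N V g r' r2 p' D'"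
    have "p = p0" using S1(2)[OF *(1) r0(2)] by simp
    then show "scheme1_profit N g r' r2 c p' D' \<le> scheme1_profit N g r0 r2 c p D"
      using S1[OF *(1) r0(2)] S1[OF *(3,2)] \<phi>_less[of p'] by (cases "p' = p0") auto
  qed (use r0 ex1 in auto)
  have opt1: "r = r0" if opt: "scheme1_optimal N V g r2 c r" for r
  proof -
    obtain p D p' D' where *: "scheme1_equilibrium N V g r r2 p D" "scheme1_equilibrium N V g r0 r2 p' D'"
      using ex1 opt by (auto simp: scheme1_optimal_def)
    have r: "r \<in> {0..1}" using opt by (simp add: scheme1_optimal_def)
    have "scheme1_profit N g r0 r2 c p' D' \<le> scheme1_profit N g r r2 c p D"
      using opt * r0(2) unfolding scheme1_optimal_def by blast
    then have "\<phi> p0 \<le> \<phi> p" using S1[OF *(1) r] S1[OF *(2) r0(2)] by simp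
    then show ?thesis using \<phi>_less[of p] S1[OF *(1) r] by force
  qed
  have S2: "0 \<le> q" "q ^ (N - 1) * (V - g + r * g) = r * g + c" "scheme2_revenue N g r r2 c q E = (1 - q ^ N) * V"
    if "scheme2_equilibrium N V g r r2 c q E" "r \<in> {0..1}" for r q E
    using scheme2_equilibriumD[OF N par(1,2) _ par(3) _ c(2) that(1)] that(2) c by auto
  \<comment> \<open>As \<open>c < V - g\<close>, the ratio
    \<open>(r * g + c) / (V - g + r * g)\<close> grows with \<open>r\<close>: a penalty only adds
    abstention and costs revenue.\<close>
  have opt_0: "scheme2_optimal N V g r2 c 0"
    unfolding scheme2_optimal_def
  proof (intro conjI allI impI; (elim conjE)?)
    fix p D r' p' D'
    assume *: "scheme2_equilibrium N V g 0 r2 c p D" "r' \<in> {0..1}" "scheme2_equilibrium N V g r' r2 c p' D'"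
    have pos: "0 < V - g + r' * g" using par *(2) by (simp add: add_pos_nonneg)
    have "p ^ (N - 1) = c / (V - g)"
      using S2(2)[OF *(1)] par by (simp add: eq_divide_eq)
    also have "\<dots> \<le> (r' * g + c) / (V - g + r' * g)"
    proof -
      have "c * (r' * g) \<le> (V - g) * (r' * g)" using c par *(2) by (intro mult_right_mono) auto
      then have "c * (V - g + r' * g) \<le> (r' * g + c) * (V - g)" by (simp add: algebra_simps)
      then show ?thesis using pos par by (simp add: frac_le_eq divide_le_eq le_divide_eq)
    qed
    also have "\<dots> = p' ^ (N - 1)"
      using S2(2)[OF *(3,2)] pos by (simp add: divide_eq_eq)
    finally have "p \<le> p'" by (rule pow_le) (rule S2(1)[OF *(3,2)])
    then have "p ^ N \<le> p' ^ N"
      using S2(1)[OF *(1)] by (intro power_mono) auto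
    then show "scheme2_revenue N g r' r2 c p' D' \<le> scheme2_revenue N g 0 r2 c p D"
      using S2(3)[OF *(1)] S2(3)[OF *(3,2)] par by simp
  qed (use ex2 in auto)
  \<comment> \<open>A common upper bound for both abstention probabilities \<open>q\<close> and
    \<open>p0\<close>.\<close>
  define \<rho> where "\<rho> = root (N - 1) (2 * c / (V - g))"
  have \<rho>: "0 < \<rho>" "\<rho> ^ (N - 1) = 2 * c / (V - g)"
    using c par N1 by (auto simp: \<rho>_def)
  have less: "\<phi> p0 < (1 - q ^ N) * V" if "scheme2_equilibrium N V g r0 r2 c q E" for q E
  proof -
    note q = S2[OF that r0(2)]
    have "(q ^ (N - 1) * (V - g)) * V = (r0 * g + c) * (V - c)"
      using q(2) Vc unfolding r0_sum by (simp add: field_simps)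
    also have "\<dots> = c * (2 * V - g - c)"
      unfolding r0g using Vc by (simp add: field_simps)
    also have "\<dots> \<le> (2 * c) * V" using c par by simp
    finally have "q ^ (N - 1) * (V - g) \<le> 2 * c"
      by (rule mult_right_le_imp_le) (use par in simp)
    then have qpow: "q ^ (N - 1) \<le> 2 * c / (V - g)"
      using par by (simp add: le_divide_eq)
    have "q \<le> \<rho>" by (rule pow_le) (use qpow \<rho> in auto)
    have p0pow: "c / V \<le> 2 * c / (V - g)" using c par by (intro frac_le) auto
    have "p0 \<le> \<rho>" by (rule pow_le) (use p0 \<rho> p0pow in simp_all)
    have "V * q ^ N \<le> V * (\<rho> * (2 * c / (V - g)))"
      unfolding pow_N using \<open>q \<le> \<rho>\<close> qpow q(1) par \<rho>(1) by (intro mult_left_mono mult_mono) auto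
    also have "\<dots> = c * (\<rho> * (2 * V / (V - g)))" by simp
    finally have 1: "V * q ^ N \<le> c * (\<rho> * (2 * V / (V - g)))" .
    \<comment> \<open>From here Scheme 1 is bounded: it loses \<open>c * (N - (N - 1) * p0)\<close>
      of \<open>V\<close>, hence at least \<open>c * N * (1 - \<rho>)\<close>, against the Scheme 2
      loss bounded in fact 1.\<close>
    have "V * p0 ^ N = c * p0" unfolding pow_N p0(2) using par by simp
    then have "\<phi> p0 = V - c * N + c * ((N - 1) * p0)"
      using N by (simp add: \<phi>_def algebra_simps of_nat_diff)
    also have "(N - 1) * p0 \<le> N * \<rho>"
      using \<open>p0 \<le> \<rho>\<close> p0(1) by (intro mult_mono) auto
    then have "V - c * N + c * ((N - 1) * p0) \<le> V - c * N + c * (N * \<rho>)" using c by simp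
    also have "\<dots> = V - c * (N - \<rho> * (2 * V / (V - g) + N)) - c * (\<rho> * (2 * V / (V - g)))"
      by (simp add: algebra_simps)
    also have "\<dots> < V - c * (\<rho> * (2 * V / (V - g)))"
      using small c(1) unfolding \<rho>_def[symmetric] by simp
    also have "\<dots> \<le> V - V * q ^ N" using 1 by simp
    finally show ?thesis by (simp add: algebra_simps)
  qed
  have "(\<exists>p D. scheme2_equilibrium N V g s1 r2 c p D) \<and>
       (\<forall>p D q E. scheme1_equilibrium N V g r1 r2 p D \<and> scheme2_equilibrium N V g s1 r2 c q E \<longrightarrow>
          scheme1_profit N g r1 r2 c p D < scheme2_revenue N g s1 r2 c q E)"
    if r1: "scheme1_optimal N V g r2 c r1" and s1: "s1 = r1 \<or> scheme2_optimal N V g r2 c s1" for r1 s1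
  proof (intro conjI allI impI; (elim conjE)?)
    have [simp]: "r1 = r0" by (rule opt1[OF r1])
    have s1': "s1 \<in> {0..1}" using s1 r0 by (auto simp: scheme2_optimal_def)
    then show "\<exists>p D. scheme2_equilibrium N V g s1 r2 c p D" by (rule ex2)
    fix p D q E
    assume 1: "scheme1_equilibrium N V g r1 r2 p D" and 2: "scheme2_equilibrium N V g s1 r2 c q E"
    obtain q' E' where 3: "scheme2_equilibrium N V g r0 r2 c q' E'" using ex2[OF r0(2)] by blast
    have "scheme1_profit N g r1 r2 c p D = \<phi> p0" using S1[of r0 p D] 1 r0(2) by simp
    also have "\<phi> p0 < scheme2_revenue N g s1 r2 c q E"
      using s1
    proof
      assume "s1 = r1"
      then show ?thesis using S2(3)[OF 2 s1'] less[of q E] 2 by simp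
    next
      \<comment> \<open>The optimal Scheme 2 rate does at least as well as \<open>r0\<close>, where
        the comparison is already settled.\<close>
      assume "scheme2_optimal N V g r2 c s1"
      then have "scheme2_revenue N g r0 r2 c q' E' \<le> scheme2_revenue N g s1 r2 c q E"
        using 2 3 r0(2) unfolding scheme2_optimal_def by blast
      then show ?thesis using less[OF 3] S2(3)[OF 3 r0(2)] by simp
    qed
    finally show "scheme1_profit N g r1 r2 c p D < scheme2_revenue N g s1 r2 c q E" .
  qed
  then show ?thesis using opt_r0 opt_0 by blast
qed

theorem theorem5p3:
  fixes N :: nat and V g r2 :: real
  assumes "2 \<le> N" and "0 < g" and "g < V" and "0 \<le> r2" and "r2 \<le> 1"
  shows "\<forall>\<^sub>F c in at_right 0.
    (\<exists>r1. scheme1_optimal N V g r2 c r1) \<and>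
    (\<exists>r1. scheme2_optimal N V g r2 c r1) \<and>
    (\<forall>r1 s1. scheme1_optimal N V g r2 c r1 \<and> (s1 = r1 \<or> scheme2_optimal N V g r2 c s1) \<longrightarrow>
       (\<exists>p D. scheme2_equilibrium N V g s1 r2 c p D) \<and>
       (\<forall>p D q E. scheme1_equilibrium N V g r1 r2 p D \<and> scheme2_equilibrium N V g s1 r2 c q E \<longrightarrow>
          scheme1_profit N g r1 r2 c p D < scheme2_revenue N g s1 r2 c q E))"
proof -
  \<comment> \<open>The root is continuous and vanishes at 0, so the left side of
    \<open>small\<close> tends to 0, which is below \<open>N\<close>.\<close>
  have "((\<lambda>c. root (N - 1) (2 * c / (V - g)) * (2 * V / (V - g) + N))
      \<longlongrightarrow> root (N - 1) (2 * 0 / (V - g)) * (2 * V / (V - g) + N)) (at_right 0)"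
    using assms by (intro tendsto_intros) auto
  then have "\<forall>\<^sub>F c in at_right 0. root (N - 1) (2 * c / (V - g)) * (2 * V / (V - g) + N) < N"
    using assms(1) by (elim order_tendstoD) simp
  moreover have "\<forall>\<^sub>F c in at_right 0. c \<in> {0<..<min (V - g) g}"
    using assms by (intro eventually_at_right_real) simp
  ultimately show ?thesis
    by eventually_elim (intro small_cost_comparison, use assms in auto)
qed

end
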